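(* For all integers $k,n$ with $6 \le k \le n$ the following inequalities hold: (i) $\mathrm{sat}(k,k)\le \frac{15}{16}\,2^{k-1}$; (ii) $\mathrm{wsat}(n,k) = O\!\left(\frac{\log k}{k}2^k\right)$, where the implied constant is absolute (independent of $n$ and $k$).
   Context: Write $[n]=\{1,\dots,n\}$ and let $2^{[n]}$ be its power set. For positive integers $k,n$ and a family $\mathcal F\subseteq 2^{[n]}$ consider the two properties: (1) there do not exist $k+1$ distinct sets $F_1,\dots,F_{k+1}\in\mathcal F$ forming a $(k+1)$-chain $F_1\subset F_2\subset\dots\subset F_{k+1}$; (2) for every $S\in 2^{[n]}\setminus\mathcal F$ there exist $k$ distinct sets $F_1,\dots,F_k\in\mathcal F$ such that $S$ together with $F_1,\dots,F_k$ forms a $(k+1)$-chain (i.e. these $k+1$ distinct sets are totally ordered by inclusion). The family $\mathcal F$ is weakly saturating $k$-Sperner if it satisfies (2), and (strongly) saturating $k$-Sperner if it satisfies both (1) and (2). Let $\mathrm{sat}(n,k)$ (respectively $\mathrm{wsat}(n,k)$) denote the minimum number of sets in a strongly saturating (respectively weakly saturating) $k$-Sperner family $\mathcal F\subseteq 2^{[n]}$. *)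

theory Defs
  imports Complex_Main
begin

(* For m > 0 such a set C is the same thing as F_1 \<subset> ... \<subset> F_m:
   its m distinct members are totally ordered by inclusion. *)
definition is_chain_of_size :: "nat \<Rightarrow> 'a set set \<Rightarrow> bool" where
  "is_chain_of_size m C \<longleftrightarrow> card C = m \<and> chain\<^sub>\<subseteq> C"

definition no_long_chain :: "nat \<Rightarrow> 'a set set \<Rightarrow> bool" where
  "no_long_chain k \<F> \<longleftrightarrow> \<not> (\<exists>C\<subseteq>\<F>. is_chain_of_size (k + 1) C)"

definition chain_completing :: "nat \<Rightarrow> nat \<Rightarrow> nat set set \<Rightarrow> bool" where
  "chain_completing n k \<F> \<longleftrightarrow>
     (\<forall>S \<in> Pow {1..n} - \<F>. \<exists>G\<subseteq>\<F>. card G = k \<and> is_chain_of_size (k + 1) (insert S G))"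

definition weakly_saturating_Sperner :: "nat \<Rightarrow> nat \<Rightarrow> nat set set \<Rightarrow> bool" where
  "weakly_saturating_Sperner n k \<F> \<longleftrightarrow> \<F> \<subseteq> Pow {1..n} \<and> chain_completing n k \<F>"

definition saturating_Sperner :: "nat \<Rightarrow> nat \<Rightarrow> nat set set \<Rightarrow> bool" where
  "saturating_Sperner n k \<F> \<longleftrightarrow>
     \<F> \<subseteq> Pow {1..n} \<and> no_long_chain k \<F> \<and> chain_completing n k \<F>"

definition sat :: "nat \<Rightarrow> nat \<Rightarrow> nat" where
  "sat n k = (LEAST m. \<exists>\<F>. saturating_Sperner n k \<F> \<and> card \<F> = m)"

definition wsat :: "nat \<Rightarrow> nat \<Rightarrow> nat" where
  "wsat n k = (LEAST m. \<exists>\<F>. weakly_saturating_Sperner n k \<F> \<and> card \<F> = m)"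

(* The minima are taken over nonempty sets, hence are attained. *)

lemma saturating_Sperner_exists: "\<exists>\<F>. saturating_Sperner n k \<F>"
proof -
  let ?A = "{\<F>. \<F> \<subseteq> Pow {1..n} \<and> no_long_chain k \<F>}"
  have "finite ?A"
    by (rule finite_subset[of _ "Pow (Pow {1..n})"]) auto
  moreover have "{} \<in> ?A"
    by (auto simp: no_long_chain_def is_chain_of_size_def)
  ultimately obtain \<F> where F: "\<F> \<in> ?A" and max: "\<And>\<G>. \<G> \<in> ?A \<Longrightarrow> \<F> \<subseteq> \<G> \<Longrightarrow> \<F> = \<G>"
    using finite_has_maximal[of ?A] by (metis (no_types, lifting) empty_iff)
  have "chain_completing n k \<F>"
    unfolding chain_completing_def
  proof
    fix S assume S: "S \<in> Pow {1..n} - \<F>"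
    then have "insert S \<F> \<notin> ?A" using max[of "insert S \<F>"] by auto
    then obtain C where C: "C \<subseteq> insert S \<F>" "is_chain_of_size (k + 1) C"
      using S F by (auto simp: no_long_chain_def)
    with F have "S \<in> C" by (auto simp: no_long_chain_def)
    then have "insert S (C - {S}) = C" "card (C - {S}) = k"
      using C by (auto simp: is_chain_of_size_def)
    with C show "\<exists>G\<subseteq>\<F>. card G = k \<and> is_chain_of_size (k + 1) (insert S G)"
      by (intro exI[of _ "C - {S}"]) auto
  qed
  with F show ?thesis by (auto simp: saturating_Sperner_def)
qed

lemma sat_attained: "\<exists>\<F>. saturating_Sperner n k \<F> \<and> card \<F> = sat n k"
  unfolding sat_def by (rule LeastI_ex) (use saturating_Sperner_exists in auto)

lemma wsat_attained: "\<exists>\<F>. weakly_saturating_Sperner n k \<F> \<and> card \<F> = wsat n k"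
proof -
  have "\<exists>\<F>. weakly_saturating_Sperner n k \<F>"
    using saturating_Sperner_exists[of n k]
    unfolding saturating_Sperner_def weakly_saturating_Sperner_def by blast
  then show ?thesis
    unfolding wsat_def by - (rule LeastI_ex, auto)
qed

end

theory Submission
  imports Defs
begin

text \<open>For \<open>k = n\<close> a family is saturating iff its complement is a minimal set of subsets meeting every
  maximal chain of \<open>2^[n]\<close>. A family of \<open>30\<close> sets of this kind for \<open>n = 6\<close> beats the trivial bound
  \<open>2^(n - 1) = 32\<close>, and adjoining \<open>F \<union> {n + 1}\<close> for each member \<open>F\<close> doubles the
  size in each further dimension.

  For the weak version it suffices to find \<open>G \<subseteq> 2^[k]\<close> such that every nonempty \<open>S \<subseteq> [k]\<close> has an
  \<open>x \<in> S\<close> with \<open>S - {x} \<in> G\<close>. Descending greedily, \<open>G\<close> contains a chain of \<open>card S\<close> proper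
  subsets of \<open>S\<close>, so \<open>G\<close> together with the complements in \<open>[n]\<close> of its members contains, for every
  \<open>S \<subseteq> [n]\<close>, a chain of \<open>card (S \<inter> [k])\<close> sets below \<open>S\<close> and one of \<open>card ([k] - S)\<close> sets above.\<close>

section \<open>Saturating families inside a full cube\<close>

lemma chain_subset_insert_all:
  assumes "chain\<^sub>\<subseteq> C" "\<And>A. A \<in> C \<Longrightarrow> A \<subseteq> B \<or> B \<subseteq> A"
  shows "chain\<^sub>\<subseteq> (insert B C)"
  using assms unfolding chain_subset_def by blast

text \<open>Both completions have this shape: a chain \<open>A\<close> strictly below
  \<open>S\<close> and a chain \<open>B\<close> strictly above it. Being separated by
  \<open>S\<close>, they are disjoint, so their sizes add.\<close>

lemma chain_subset_sandwich:
  assumes "chain\<^sub>\<subseteq> A" "chain\<^sub>\<subseteq> B" "\<And>X. X \<in> A \<Longrightarrow> X \<subset> S" "\<And>Y. Y \<in> B \<Longrightarrow> S \<subset> Y"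
    and "finite A" "finite B"
  shows "is_chain_of_size (card A + card B + 1) (insert S (A \<union> B))"
    and "card (A \<union> B) = card A + card B"
proof -
  have disj: "A \<inter> B = {}"
    using assms(3,4) by blast
  then show card: "card (A \<union> B) = card A + card B"
    using assms(5,6) by (simp add: card_Un_disjoint)
  have "S \<notin> A \<union> B"
    using assms(3,4) by blast
  then have "card (insert S (A \<union> B)) = card A + card B + 1"
    using card assms(5,6) by simp
  moreover have "chain\<^sub>\<subseteq> (insert S (A \<union> B))"
    by (intro chain_subset_insert_all) (use assms(1-4) in \<open>unfold chain_subset_def, blast+\<close>)
  ultimately show "is_chain_of_size (card A + card B + 1) (insert S (A \<union> B))"
    by (simp add: is_chain_of_size_def)
qed

section \<open>Splittings of the cube and the saturating families they yield\<close>

text \<open>For \<open>k = n\<close> a \<open>(k + 1)\<close>-chain is a maximal chain of the cube. Such a chain is excluded from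
  \<open>D \<union> U\<close> because it would have to step from \<open>D\<close> directly to \<open>U\<close>.\<close>

locale splitting =
  fixes n :: nat and D U :: "nat set set"
  assumes D_subset: "D \<subseteq> Pow {1..n}" and U_subset: "U \<subseteq> Pow {1..n}"
    and empty_in_D: "{} \<in> D" and full_in_U: "{1..n} \<in> U" and disjoint: "D \<inter> U = {}"
    and no_step: "\<forall>A\<in>D. \<forall>x\<in>{1..n}. insert x A \<notin> U"
    and D_down: "\<forall>A\<in>D. A = {} \<or> (\<exists>x\<in>A. A - {x} \<in> D)"
    and U_up: "\<forall>A\<in>U. A = {1..n} \<or> (\<exists>x\<in>{1..n} - A. insert x A \<in> U)"
    and between: "\<forall>S\<in>Pow {1..n}. S \<in> D \<or> S \<in> U \<or>
        (\<exists>x\<in>S. S - {x} \<in> D) \<and> (\<exists>x\<in>{1..n} - S. insert x S \<in> U)"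

text \<open>Comparable finite sets of equal size coincide, so the \<open>n + 1\<close> members have
  \<open>n + 1\<close> distinct sizes in \<open>{0..n}\<close> and exhaust that range.\<close>

lemma full_chain_level:
  assumes "is_chain_of_size (n + 1) C" "C \<subseteq> Pow {1..n}" "i \<le> n"
  shows "\<exists>A\<in>C. card A = i"
proof -
  have fin: "finite A" if "A \<in> C" for A
    using assms(2) that finite_subset by blast
  have "inj_on card C"
  proof (rule inj_onI)
    fix A B assume "A \<in> C" "B \<in> C" "card A = card B"
    then show "A = B"
      using assms(1) fin unfolding is_chain_of_size_def chain_subset_def by (metis card_subset_eq)
  qed
  then have "card (card ` C) = n + 1"
    using assms(1) by (simp add: card_image is_chain_of_size_def)
  moreover have "card ` C \<subseteq> {0..n}"
  proof
    fix m assume "m \<in> card ` C"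
    then obtain A where "A \<in> C" "m = card A"
      by blast
    then have "A \<subseteq> {1..n}"
      using assms(2) by blast
    then show "m \<in> {0..n}"
      using card_mono[of "{1..n}" A] \<open>m = card A\<close> by simp
  qed
  ultimately have "card ` C = {0..n}"
    by (intro card_subset_eq) auto
  then show ?thesis
    using assms(3) by (metis atLeastAtMost_iff imageE zero_le)
qed

lemma full_chain_step:
  assumes "chain\<^sub>\<subseteq> C" "A \<in> C" "B \<in> C" "finite A" "finite B" "card B = Suc (card A)"
  shows "\<exists>x\<in>B. B = insert x A"
proof -
  have "A \<subseteq> B"
    using assms by (metis card_mono chain_subset_def not_less_eq_eq order_refl)
  moreover have "card (B - A) = 1"
    using assms calculation by (simp add: card_Diff_subset)
  then obtain x where "B - A = {x}"
    by (rule card_1_singletonE)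
  ultimately show ?thesis
    by blast
qed

lemma (in splitting) no_long_chain: "no_long_chain n (D \<union> U)"
  unfolding no_long_chain_def
proof
  assume "\<exists>C\<subseteq>D \<union> U. is_chain_of_size (n + 1) C"
  then obtain C where C: "C \<subseteq> D \<union> U" "is_chain_of_size (n + 1) C"
    by blast
  then have sub: "C \<subseteq> Pow {1..n}"
    using D_subset U_subset by blast
  have fin: "finite A" if "A \<in> C" for A
    using sub that finite_subset by blast
  \<comment> \<open>Climbing level by level from \<open>{}\<close>, the chain adds one element at a
    time, so \<open>no_step\<close> keeps it inside \<open>D\<close>; this is absurd on the top
    level, where \<open>{1..n}\<close> lies in \<open>U\<close>.\<close>
  have "\<exists>A\<in>C \<inter> D. card A = i" if "i \<le> n" for i
    using that
  proof (induction i)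
    case 0
    obtain A where "A \<in> C" "card A = 0"
      using full_chain_level[OF C(2) sub, of 0] by auto
    then show ?case
      using empty_in_D fin by auto
  next
    case (Suc i)
    then obtain A where A: "A \<in> C" "A \<in> D" "card A = i"
      by auto
    obtain B where B: "B \<in> C" "card B = Suc i"
      using full_chain_level[OF C(2) sub Suc.prems] by auto
    have "\<exists>x\<in>B. B = insert x A"
      using full_chain_step[of C A B] C(2) A B fin by (simp add: is_chain_of_size_def)
    then obtain x where x: "x \<in> B" "B = insert x A"
      by blast
    then have "x \<in> {1..n}"
      using B sub by blast
    then have "B \<notin> U"
      using no_step A(2) x(2) by simp
    then show ?case
      using B C(1) by blast
  qed
  then obtain A where A: "A \<in> C" "A \<in> D" "card A = n"
    by blast
  then have "A = {1..n}"
    using sub by (intro card_subset_eq) auto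
  then show False
    using A(2) full_in_U disjoint by blast
qed

text \<open>Repeated one-element removals lead from \<open>A\<close> down to \<open>{}\<close>;
  counting both ends, this visits \<open>card A + 1\<close> sets.\<close>

lemma descending_chain:
  assumes "\<And>A. A \<in> D \<Longrightarrow> A = {} \<or> (\<exists>x\<in>A. A - {x} \<in> D)" "finite A" "A \<in> D"
  shows "\<exists>C\<subseteq>D. finite C \<and> chain\<^sub>\<subseteq> C \<and> (\<forall>B\<in>C. B \<subseteq> A) \<and> card C = Suc (card A)"
  using assms(2,3)
proof (induction "card A" arbitrary: A)
  case 0
  then show ?case
    by (intro exI[of _ "{A}"]) (auto simp: chain_subset_def)
next
  case (Suc m)
  then obtain x where x: "x \<in> A" "A - {x} \<in> D"
    using assms(1)[of A] by auto
  with Suc have "m = card (A - {x})" "finite (A - {x})"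
    by auto
  with Suc x obtain C where C: "C \<subseteq> D" "finite C" "chain\<^sub>\<subseteq> C" "\<forall>B\<in>C. B \<subseteq> A - {x}"
      "card C = Suc m"
    by metis
  have "A \<notin> C"
    using C x by blast
  then show ?case
    using C Suc.prems Suc.hyps(2) chain_subset_insert_all[of C A]
    by (intro exI[of _ "insert A C"]) auto
qed

lemma chain_subset_complement:
  assumes "chain\<^sub>\<subseteq> C"
  shows "chain\<^sub>\<subseteq> ((-) V ` C)"
  using assms unfolding chain_subset_def by blast

lemma inj_on_complement: "C \<subseteq> Pow V \<Longrightarrow> inj_on ((-) V) C"
  by (rule inj_onI) blast

text \<open>Complementation turns the ascent property \<open>U_up\<close> into a descent property,
  so that \<open>descending_chain\<close> also serves the upper half.\<close>

lemma (in splitting) complement_down: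
  assumes "A \<in> (-) {1..n} ` U"
  shows "A = {} \<or> (\<exists>x\<in>A. A - {x} \<in> (-) {1..n} ` U)"
proof -
  obtain B where B: "B \<in> U" "A = {1..n} - B"
    using assms by blast
  show ?thesis
  proof (cases "B = {1..n}")
    case False
    then obtain x where x: "x \<in> {1..n} - B" "insert x B \<in> U"
      using U_up B(1) by metis
    then have "A - {x} = {1..n} - insert x B" "x \<in> A"
      using B by auto
    then show ?thesis
      using x(2) by blast
  qed (use B in auto)
qed

text \<open>By \<open>between\<close>, a set \<open>S\<close> outside the family has a neighbour
  below in \<open>D\<close> and one above in \<open>U\<close>. Descending from the first and
  ascending from the second completes a maximal chain through \<open>S\<close>.\<close>

lemma (in splitting) chain_completing: "chain_completing n n (D \<union> U)"
  unfolding chain_completing_def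
proof
  fix S assume S: "S \<in> Pow {1..n} - (D \<union> U)"
  then have "(\<exists>x\<in>S. S - {x} \<in> D) \<and> (\<exists>x\<in>{1..n} - S. insert x S \<in> U)"
    using between by (metis DiffD1 DiffD2 UnI1 UnI2)
  then obtain x y where x: "x \<in> S" "S - {x} \<in> D" and y: "y \<in> {1..n} - S" "insert y S \<in> U"
    by blast
  let ?T = "{1..n} - insert y S"
  have sub: "S \<subseteq> {1..n}" and fin: "finite S"
    using S finite_subset by blast+
  obtain C where C: "C \<subseteq> D" "finite C" "chain\<^sub>\<subseteq> C" "\<forall>B\<in>C. B \<subseteq> S - {x}"
      "card C = Suc (card (S - {x}))"
    using descending_chain[of D "S - {x}"] D_down x(2) fin by (metis finite_Diff)
  have "?T \<in> (-) {1..n} ` U"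
    using y(2) by (rule imageI)
  then obtain E where E: "E \<subseteq> (-) {1..n} ` U" "finite E" "chain\<^sub>\<subseteq> E" "\<forall>B\<in>E. B \<subseteq> ?T"
      "card E = Suc (card ?T)"
    using descending_chain[OF complement_down, of ?T] by (metis finite_Diff finite_atLeastAtMost)
  let ?E = "(-) {1..n} ` E"
  have EU: "?E \<subseteq> U"
  proof
    fix B assume "B \<in> ?E"
    then obtain V where "V \<in> U" "B = {1..n} - ({1..n} - V)"
      using E(1) by blast
    moreover from this have "{1..n} - ({1..n} - V) = V"
      using U_subset by blast
    ultimately show "B \<in> U"
      by metis
  qed
  have cE: "card ?E = card E"
    using E(4) by (intro card_image inj_on_complement) auto
  \<comment> \<open>The lower chain has \<open>card S\<close> members and the upper one
    \<open>n - card S\<close>; together they supply the \<open>n\<close> required sets.\<close>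
  have "card C = card S"
    using C(5) x(1) fin by (metis card_Suc_Diff1)
  moreover have "card (insert y S) = Suc (card S)" "card (insert y S) \<le> n"
    using card_mono[of "{1..n}" "insert y S"] sub y(1) fin by auto
  moreover have "card ?T = n - card (insert y S)"
    using sub y(1) fin by (subst card_Diff_subset) auto
  ultimately have card: "card C + card ?E = n"
    using E(5) cE by linarith
  have up: "S \<subset> B" if "B \<in> ?E" for B
  proof -
    obtain V where "B = {1..n} - V" "V \<subseteq> ?T"
      using \<open>B \<in> ?E\<close> E(4) by blast
    then show ?thesis
      using sub y(1) by blast
  qed
  have down: "B \<subset> S" if "B \<in> C" for B
    using that C(4) x(1) by blast
  have "is_chain_of_size (n + 1) (insert S (C \<union> ?E))" "card (C \<union> ?E) = n"
    using chain_subset_sandwich[of C ?E S, OF C(3) chain_subset_complement[OF E(3)] down up C(2)]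
      E(2) card by simp_all
  then show "\<exists>G\<subseteq>D \<union> U. card G = n \<and> is_chain_of_size (n + 1) (insert S G)"
    using C(1) EU by (intro exI[of _ "C \<union> ?E"]) blast
qed

lemma (in splitting) saturating: "saturating_Sperner n n (D \<union> U)"
  using D_subset U_subset no_long_chain chain_completing by (simp add: saturating_Sperner_def)

section \<open>Doubling a splitting when a new element is added\<close>

definition double :: "nat \<Rightarrow> nat set set \<Rightarrow> nat set set" where
  "double m D = D \<union> insert m ` D"

text \<open>The doubled family is the preimage of \<open>D\<close> under deletion of
  \<open>Suc n\<close>, which reduces the conditions on the larger cube to conditions on traces in
  \<open>{1..n}\<close>.\<close>

lemma mem_double_iff:
  assumes "D \<subseteq> Pow {1..n}"
  shows "A \<in> double (Suc n) D \<longleftrightarrow> A - {Suc n} \<in> D"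
proof -
  have new: "Suc n \<notin> B" if "B \<in> D" for B
    using assms that by fastforce
  show ?thesis
  proof
    assume "A \<in> double (Suc n) D"
    then obtain B where "B \<in> D" "A = B \<or> A = insert (Suc n) B"
      unfolding double_def by blast
    then have "A - {Suc n} = B"
      using new by blast
    then show "A - {Suc n} \<in> D"
      using \<open>B \<in> D\<close> by simp
  next
    assume A: "A - {Suc n} \<in> D"
    have "A = A - {Suc n} \<or> A = insert (Suc n) (A - {Suc n})"
      by blast
    then show "A \<in> double (Suc n) D"
      using A unfolding double_def by (metis UnI1 UnI2 imageI)
  qed
qed

text \<open>Adding or removing \<open>Suc n\<close> does not change the trace, so such a move never
  leaves its half; every other move acts on the trace as in the smaller cube.\<close>

lemma (in splitting) splitting_double: "splitting (Suc n) (double (Suc n) D) (double (Suc n) U)"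
proof -
  note mem = mem_double_iff[OF D_subset] mem_double_iff[OF U_subset]
  have full: "{1..Suc n} - {Suc n} = {1..n}"
    by auto
  show ?thesis
  proof (unfold_locales, goal_cases)
    case 1
    then show ?case using D_subset by (fastforce simp: double_def)
  next
    case 2
    then show ?case using U_subset by (fastforce simp: double_def)
  next
    case 3
    then show ?case using empty_in_D by (simp add: mem)
  next
    case 4
    then show ?case unfolding mem full by (rule full_in_U)
  next
    case 5
    then show ?case using disjoint by (auto simp: mem)
  next
    case 6
    show ?case
    proof (intro ballI)
      fix A x assume A: "A \<in> double (Suc n) D" and x: "x \<in> {1..Suc n}"
      show "insert x A \<notin> double (Suc n) U"
      proof (cases "x = Suc n")
        case True
        then show ?thesis using A disjoint by (auto simp: mem)
      next
        case False
        then show ?thesis using A x no_step by (auto simp: mem insert_Diff_if)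
      qed
    qed
  next
    case 7
    show ?case
    proof
      fix A assume A: "A \<in> double (Suc n) D"
      show "A = {} \<or> (\<exists>x\<in>A. A - {x} \<in> double (Suc n) D)"
      proof (cases "Suc n \<in> A")
        case True
        then show ?thesis using A by (intro disjI2 bexI[of _ "Suc n"]) (auto simp: mem)
      next
        case False
        then show ?thesis using A D_down by (auto simp: mem)
      qed
    qed
  next
    case 8
    show ?case
    proof
      fix A assume A: "A \<in> double (Suc n) U"
      then have sub: "A - {Suc n} \<subseteq> {1..n}"
        using U_subset by (auto simp: mem)
      show "A = {1..Suc n} \<or> (\<exists>x\<in>{1..Suc n} - A. insert x A \<in> double (Suc n) U)"
      proof (cases "Suc n \<in> A")
        case False
        then show ?thesis using A by (intro disjI2 bexI[of _ "Suc n"]) (auto simp: mem)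
      next
        case True
        show ?thesis
        proof (cases "A - {Suc n} = {1..n}")
          case eq: True
          have "A = insert (Suc n) {1..n}"
            using True eq by blast
          then show ?thesis by auto
        next
          case False
          then have "\<exists>x\<in>{1..n} - (A - {Suc n}). insert x (A - {Suc n}) \<in> U"
            using bspec[OF U_up] A unfolding mem by metis
          then obtain x where x: "x \<in> {1..n} - (A - {Suc n})" "insert x (A - {Suc n}) \<in> U"
            by (rule bexE)
          then have "insert x A - {Suc n} = insert x (A - {Suc n})" "x \<in> {1..Suc n} - A"
            by auto
          then show ?thesis
            using x(2) unfolding mem by metis
        qed
      qed
    qed
  next
    case 9
    show ?case
    proof
      fix S assume S: "S \<in> Pow {1..Suc n}"
      let ?S = "S - {Suc n}"
      have "?S \<in> Pow {1..n}"
        using S by auto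
      from bspec[OF between this]
      consider "?S \<in> D" | "?S \<in> U" | x y where "x \<in> ?S" "?S - {x} \<in> D"
        "y \<in> {1..n} - ?S" "insert y ?S \<in> U"
        by (elim disjE conjE bexE) simp_all
      then show "S \<in> double (Suc n) D \<or> S \<in> double (Suc n) U \<or>
        (\<exists>x\<in>S. S - {x} \<in> double (Suc n) D) \<and>
        (\<exists>x\<in>{1..Suc n} - S. insert x S \<in> double (Suc n) U)"
      proof cases
        case 3
        have "S - {x} - {Suc n} = ?S - {x}" "insert y S - {Suc n} = insert y ?S"
          using 3 by auto
        then have "S - {x} \<in> double (Suc n) D" "insert y S \<in> double (Suc n) U"
          using 3 by (simp_all add: mem)
        moreover have "x \<in> S" "y \<in> {1..Suc n} - S"
          using 3 by auto
        ultimately show ?thesis by blast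
      qed (simp_all add: mem)
    qed
  qed
qed

lemma card_double_le: "finite D \<Longrightarrow> card (double m D) \<le> 2 * card D"
  unfolding double_def using card_Un_le[of D "insert m ` D"] card_image_le[of D "insert m"] by linarith

section \<open>The initial splitting for \<open>n = 6\<close> and its doublings\<close>

text \<open>Found with a SAT solver.\<close>

definition D6 :: "nat set set" where
  "D6 = {{}, {1}, {2}, {3}, {4}, {1, 5}, {1, 6}, {2, 4}, {3, 5}, {3, 6},
         {1, 2, 4}, {1, 5, 6}, {2, 3, 4}, {3, 5, 6}, {1, 2, 4, 6}}"

definition U6 :: "nat set set" where
  "U6 = {{5, 6}, {1, 2, 3}, {1, 3, 4}, {2, 5, 6}, {4, 5, 6}, {1, 2, 3, 5}, {1, 2, 3, 6}, {1, 3, 4, 5},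
         {1, 3, 4, 6}, {2, 4, 5, 6}, {1, 2, 3, 4, 5}, {1, 2, 3, 5, 6}, {1, 3, 4, 5, 6}, {2, 3, 4, 5, 6}, {1, 2, 3, 4, 5, 6}}"

lemma atLeastAtMost_6: "{1..6} = {1, 2, 3, 4, 5, 6 :: nat}"
  by auto

text \<open>Comparing explicit sets becomes comparing Boolean lists entry by entry, which the
  simplifier can evaluate.\<close>

definition charvec :: "nat set \<Rightarrow> bool list" where
  "charvec A = map (\<lambda>x. x \<in> A) [1, 2, 3, 4, 5, 6]"

text \<open>The family occurs twice, as \<open>\<F>\<close> and \<open>\<G>\<close>, so that a
  defining equation can be plugged in: the constant stays folded on the left and its listed members
  appear on the right.\<close>

lemma mem_iff_charvec:
  assumes "\<F> = \<G>" "\<G> \<subseteq> Pow {1..6}" "A \<subseteq> {1..6}"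
  shows "A \<in> \<F> \<longleftrightarrow> (\<exists>B\<in>\<G>. charvec A = charvec B)"
proof -
  have "A = B" if "B \<in> \<G>" "charvec A = charvec B" for B
  proof -
    have "A = B \<longleftrightarrow> (\<forall>x\<in>{1..6}. x \<in> A \<longleftrightarrow> x \<in> B)"
      using assms(2,3) that(1) by blast
    also have "\<dots>"
      using that(2) unfolding atLeastAtMost_6 charvec_def by simp
    finally show ?thesis by simp
  qed
  then show ?thesis
    using assms(1) by blast
qed

lemma D6_U6_subset: "D6 \<subseteq> Pow {1..6}" "U6 \<subseteq> Pow {1..6}"
  unfolding D6_def U6_def atLeastAtMost_6 by simp_all

lemmas mem_D6_iff = mem_iff_charvec[OF D6_def D6_U6_subset(1)[unfolded D6_def]]
lemmas mem_U6_iff = mem_iff_charvec[OF U6_def D6_U6_subset(2)[unfolded U6_def]]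

text \<open>Moves the bound from an unknown set to an explicit one, over which the quantifier
  unfolds to a finite disjunction.\<close>

lemma bex_subset: "A \<subseteq> B \<Longrightarrow> (\<exists>x\<in>A. P x) \<longleftrightarrow> (\<exists>x\<in>B. x \<in> A \<and> P x)"
  by blast

lemma bex_Diff_iff: "(\<exists>x\<in>B - A. P x) \<longleftrightarrow> (\<exists>x\<in>B. x \<notin> A \<and> P x)"
  by blast

lemma splitting_6: "splitting 6 D6 U6"
proof
  show "D6 \<inter> U6 = {}"
    by (simp add: mem_D6_iff U6_def charvec_def del: One_nat_def)
  show "\<forall>A\<in>D6. \<forall>x\<in>{1..6}. insert x A \<notin> U6"
    unfolding D6_def by (simp add: atLeastAtMost_6 mem_U6_iff charvec_def del: One_nat_def)
  show "\<forall>A\<in>D6. A = {} \<or> (\<exists>x\<in>A. A - {x} \<in> D6)"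
    by (subst D6_def) (simp add: insert_Diff_if atLeastAtMost_6 mem_D6_iff charvec_def del: One_nat_def)
  show "\<forall>A\<in>U6. A = {1..6} \<or> (\<exists>x\<in>{1..6} - A. insert x A \<in> U6)"
    unfolding bex_Diff_iff
    by (subst U6_def) (simp add: atLeastAtMost_6 mem_U6_iff charvec_def del: One_nat_def)
  show "\<forall>S\<in>Pow {1..6}. S \<in> D6 \<or> S \<in> U6 \<or>
      (\<exists>x\<in>S. S - {x} \<in> D6) \<and> (\<exists>x\<in>{1..6} - S. insert x S \<in> U6)"
  proof
    fix S :: "nat set" assume "S \<in> Pow {1..6}"
    then have S: "S \<subseteq> {1, 2, 3, 4, 5, 6}" "\<And>x. S - {x} \<subseteq> {1, 2, 3, 4, 5, 6}"
      unfolding atLeastAtMost_6 by blast+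
    show "S \<in> D6 \<or> S \<in> U6 \<or>
      (\<exists>x\<in>S. S - {x} \<in> D6) \<and> (\<exists>x\<in>{1..6} - S. insert x S \<in> U6)"
      unfolding bex_Diff_iff bex_subset[OF S(1)]
      \<comment> \<open>The 64 subsets of \<open>{1..6}\<close> are checked one by one.\<close>
      by (cases "1 \<in> S"; cases "2 \<in> S"; cases "3 \<in> S"; cases "4 \<in> S"; cases "5 \<in> S"; cases "6 \<in> S")
        (simp_all add: S atLeastAtMost_6 mem_D6_iff mem_U6_iff charvec_def del: One_nat_def)
  qed
  show "{} \<in> D6"
    by (simp add: D6_def)
  show "{1..6} \<in> U6"
    unfolding U6_def atLeastAtMost_6 by (simp only: insert_iff simp_thms)
qed (rule D6_U6_subset)+

lemma card_6: "card D6 \<le> 15" "card U6 \<le> 15"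
  unfolding D6_def U6_def by (simp_all add: card_insert_le_m1 del: One_nat_def)

lemma splitting_exists:
  assumes "6 \<le> n"
  shows "\<exists>D U. splitting n D U \<and> card D \<le> 15 * 2 ^ (n - 6) \<and> card U \<le> 15 * 2 ^ (n - 6)"
  using assms
proof (induction n rule: dec_induct)
  case base
  show ?case
    using splitting_6 card_6 by auto
next
  case (step n)
  then obtain D U where DU: "splitting n D U" "card D \<le> 15 * 2 ^ (n - 6)" "card U \<le> 15 * 2 ^ (n - 6)"
    by blast
  then have "finite D" "finite U"
    using splitting.D_subset[OF DU(1)] splitting.U_subset[OF DU(1)] by (auto intro: finite_subset)
  then have "card (double (Suc n) D) \<le> 2 * card D" "card (double (Suc n) U) \<le> 2 * card U"
    by (simp_all add: card_double_le)
  moreover have "Suc n - 6 = Suc (n - 6)"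
    using step(1) by linarith
  then have "15 * 2 ^ (Suc n - 6) = 2 * (15 * 2 ^ (n - 6) :: nat)"
    by (simp only: power_Suc mult.left_commute)
  ultimately have "card (double (Suc n) D) \<le> 15 * 2 ^ (Suc n - 6)"
    "card (double (Suc n) U) \<le> 15 * 2 ^ (Suc n - 6)"
    using DU(2,3) by linarith+
  then show ?case
    using splitting.splitting_double[OF DU(1)] by blast
qed

section \<open>Bounding the minima, and the bound on \<open>sat k k\<close>\<close>

lemma sat_le: "saturating_Sperner n k \<F> \<Longrightarrow> sat n k \<le> card \<F>"
  unfolding sat_def by (rule Least_le) blast

lemma wsat_le: "weakly_saturating_Sperner n k \<F> \<Longrightarrow> wsat n k \<le> card \<F>"
  unfolding wsat_def by (rule Least_le) blast

lemma sat_self_le: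
  assumes "6 \<le> k"
  shows "real (sat k k) \<le> 15 / 16 * 2 ^ (k - 1)"
proof -
  obtain D U where DU: "splitting k D U" "card D \<le> 15 * 2 ^ (k - 6)" "card U \<le> 15 * 2 ^ (k - 6)"
    using splitting_exists[OF assms] by blast
  have "sat k k \<le> card (D \<union> U)"
    by (intro sat_le splitting.saturating DU)
  also have "\<dots> \<le> 30 * 2 ^ (k - 6)"
    using card_Un_le[of D U] DU(2,3) by linarith
  finally have "real (sat k k) \<le> real (30 * 2 ^ (k - 6))"
    by linarith
  \<comment> \<open>The ratio is 30 sets against \<open>2 ^ 5 = 32\<close>.\<close>
  also have "\<dots> = 15 / 16 * 2 ^ (k - 6 + 5)"
    by (simp add: power_add)
  also have "k - 6 + 5 = k - 1"
    using assms by simp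
  finally show ?thesis .
qed

section \<open>Weakly saturating families\<close>

text \<open>Unlike in \<open>descending_chain\<close>, the starting set \<open>S\<close> may lie
  outside \<open>G\<close>; the chain begins with \<open>S - {x}\<close>, hence has
  \<open>card S\<close> members instead of one more.\<close>

lemma proper_subset_chain:
  assumes "\<And>S. S \<subseteq> V \<Longrightarrow> S \<noteq> {} \<Longrightarrow> \<exists>x\<in>S. S - {x} \<in> G" "finite S" "S \<subseteq> V"
  shows "\<exists>C\<subseteq>G. finite C \<and> chain\<^sub>\<subseteq> C \<and> (\<forall>B\<in>C. B \<subset> S) \<and> card C = card S"
  using assms(2,3)
proof (induction "card S" arbitrary: S)
  case 0
  then show ?case
    by (intro exI[of _ "{}"]) (auto simp: chain_subset_def)
next
  case (Suc m)
  then have "S \<noteq> {}"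
    by auto
  with Suc.prems(2) obtain x where x: "x \<in> S" "S - {x} \<in> G"
    using assms(1) by blast
  have "m = card (S - {x})" "finite (S - {x})" "S - {x} \<subseteq> V"
    using Suc.hyps(2) Suc.prems x(1) by auto
  from Suc.hyps(1)[OF this] obtain C where C: "C \<subseteq> G" "finite C" "chain\<^sub>\<subseteq> C"
      "\<forall>B\<in>C. B \<subset> S - {x}" "card C = card (S - {x})"
    by blast
  have "chain\<^sub>\<subseteq> (insert (S - {x}) C)"
    using C(4) by (intro chain_subset_insert_all[OF C(3)]) blast
  moreover have "S - {x} \<notin> C"
    using C(4) by blast
  then have "card (insert (S - {x}) C) = card S"
    using C(2,5) Suc.hyps(2) \<open>m = card (S - {x})\<close> by simp
  moreover have "\<forall>B\<in>insert (S - {x}) C. B \<subset> S"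
    using C(4) x(1) by blast
  ultimately show ?case
    using C(1,2) x(2) by (intro exI[of _ "insert (S - {x}) C"]) simp
qed

lemma wsat_le_twice_card:
  assumes "k \<le> n" "G \<subseteq> Pow {1..k}"
    and G: "\<And>S. S \<subseteq> {1..k} \<Longrightarrow> S \<noteq> {} \<Longrightarrow> \<exists>x\<in>S. S - {x} \<in> G"
  shows "wsat n k \<le> 2 * card G"
proof -
  let ?c = "(-) {1..n}"
  let ?F = "G \<union> ?c ` G"
  have "weakly_saturating_Sperner n k ?F"
    unfolding weakly_saturating_Sperner_def chain_completing_def
  proof (intro conjI ballI)
    show "?F \<subseteq> Pow {1..n}"
    proof -
      have "{1..k} \<subseteq> {1..n}"
        using assms(1) by simp
      then show ?thesis
        using assms(2) by blast
    qed
  next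
    fix S assume S: "S \<in> Pow {1..n} - ?F"
    \<comment> \<open>A proper subset of \<open>?S\<close> lies below \<open>S\<close>; the
      complement in \<open>{1..n}\<close> of a subset of \<open>?T\<close> lies above
      \<open>S\<close>. As \<open>?S\<close> and \<open>?T\<close> partition \<open>{1..k}\<close>,
      the two chains have \<open>k\<close> members in total, whatever \<open>n\<close> is.\<close>
    let ?S = "S \<inter> {1..k}" and ?T = "{1..k} - S"
    obtain C where C: "C \<subseteq> G" "finite C" "chain\<^sub>\<subseteq> C" "\<forall>B\<in>C. B \<subset> ?S" "card C = card ?S"
      using proper_subset_chain[of "{1..k}" G ?S] G by auto
    obtain E where E: "E \<subseteq> G" "finite E" "chain\<^sub>\<subseteq> E" "\<forall>B\<in>E. B \<subset> ?T" "card E = card ?T"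
      using proper_subset_chain[of "{1..k}" G ?T] G by auto
    have "E \<subseteq> Pow {1..n}"
    proof
      fix B assume "B \<in> E"
      then have "B \<subseteq> {1..k}"
        using E(4) by blast
      then show "B \<in> Pow {1..n}"
        using assms(1) by auto
    qed
    then have cE: "card (?c ` E) = card ?T"
      using E(5) by (metis card_image inj_on_complement)
    have down: "B \<subset> S" if "B \<in> C" for B
      using C(4) that by blast
    have up: "S \<subset> B" if "B \<in> ?c ` E" for B
    proof -
      have "S \<noteq> B"
        using that S E(1) by blast
      moreover have "S \<subseteq> B"
        using that S E(4) by blast
      ultimately show ?thesis by blast
    qed
    have "card ?S + card ?T = card (?S \<union> ?T)"
      by (rule card_Un_disjoint[symmetric]) auto
    also have "?S \<union> ?T = {1..k}"
      by blast
    finally have card: "card C + card (?c ` E) = k"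
      using C(5) cE by simp
    have "is_chain_of_size (k + 1) (insert S (C \<union> ?c ` E))" "card (C \<union> ?c ` E) = k"
      using chain_subset_sandwich[of C "?c ` E" S, OF C(3) chain_subset_complement[OF E(3)] down up C(2)]
        E(2) card by simp_all
    then show "\<exists>H\<subseteq>?F. card H = k \<and> is_chain_of_size (k + 1) (insert S H)"
      using C(1) E(1) by (intro exI[of _ "C \<union> ?c ` E"]) blast
  qed
  then have "wsat n k \<le> card ?F"
    by (rule wsat_le)
  also have "\<dots> \<le> card G + card (?c ` G)"
    by (rule card_Un_le)
  also have "card (?c ` G) \<le> card G"
    using assms(2) finite_subset by (intro card_image_le) blast
  finally show ?thesis by simp
qed

section \<open>The residue family and its size\<close>

text \<open>The Kim--Roush construction for Turan systems. If \<open>S\<close> meets every residue class modulo \<open>l\<close>,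
  then removing an element of the appropriate class produces any prescribed value of \<open>\<Sum>S mod l\<close>.\<close>

definition residue_family :: "nat \<Rightarrow> nat \<Rightarrow> nat \<Rightarrow> nat set set" where
  "residue_family k l c =
     (\<Union>i<l. Pow {x \<in> {1..k}. x mod l \<noteq> i}) \<union> {B \<in> Pow {1..k}. \<Sum>B mod l = c}"

lemma residue_family_remove:
  assumes "c < l" "S \<subseteq> {1..k}" "S \<noteq> {}"
  shows "\<exists>x\<in>S. S - {x} \<in> residue_family k l c"
proof (cases "\<exists>i<l. \<forall>x\<in>S. x mod l \<noteq> i")
  \<comment> \<open>If \<open>S\<close> misses a residue class, so does \<open>S - {x}\<close> for
    every \<open>x\<close> in \<open>S\<close>.\<close>
  case True
  then obtain i where i: "i < l" "\<forall>x\<in>S. x mod l \<noteq> i"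
    by blast
  obtain x where "x \<in> S"
    using assms(3) by blast
  moreover have "S - {x} \<in> Pow {x \<in> {1..k}. x mod l \<noteq> i}"
    using i(2) assms(2) by blast
  ultimately show ?thesis
    using i(1) unfolding residue_family_def by blast
next
  case False
  have "(\<Sum>S + (l - c)) mod l < l"
    using assms(1) by simp
  \<comment> \<open>The element to remove is congruent to \<open>\<Sum>S - c\<close>; adding
    \<open>l - c\<close> avoids truncated subtraction.\<close>
  with False obtain x where x: "x \<in> S" "x mod l = (\<Sum>S + (l - c)) mod l"
    by metis
  let ?r = "\<Sum>(S - {x})"
  have "finite S"
    using assms(2) finite_subset by blast
  then have "\<Sum>S = x + ?r"
    using x(1) by (simp add: sum.remove)
  then have "x mod l = (x + (?r + (l - c))) mod l"
    using x(2) by (simp add: add.assoc)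
  then have "l dvd ?r + (l - c)"
    using mod_eq_dvd_iff_nat[of x "x + (?r + (l - c))" l] by simp
  then obtain q where q: "?r + (l - c) = l * q"
    by (rule dvdE)
  \<comment> \<open>Since \<open>l - c\<close> is positive, one multiple of \<open>l\<close> can be
    split off, leaving \<open>?r = l * p + c\<close>.\<close>
  with assms(1) have "q \<noteq> 0"
    by (intro notI) simp
  then obtain p where "q = Suc p"
    using not0_implies_Suc by blast
  with q assms(1) have "?r = l * p + c"
    by simp
  then have "?r mod l = c"
    using assms(1) by simp
  then show ?thesis
    using x(1) assms(2) unfolding residue_family_def by blast
qed

lemma card_residue_class_ge:
  assumes "i < l"
  shows "k div l \<le> card {x \<in> {1..k}. x mod l = i}"
proof -
  \<comment> \<open>Each of the \<open>k div l\<close> full blocks of \<open>l\<close> consecutive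
    numbers contains one member of the class. Class 0 is represented by \<open>l\<close>, as 0 is
    not in \<open>{1..k}\<close>.\<close>
  let ?f = "\<lambda>j. j * l + (if i = 0 then l else i)"
  have "inj_on ?f {..<k div l}"
    using assms by (intro inj_onI) simp
  moreover have "?f ` {..<k div l} \<subseteq> {x \<in> {1..k}. x mod l = i}"
  proof
    fix x assume "x \<in> ?f ` {..<k div l}"
    then obtain j where j: "j < k div l" "x = ?f j"
      by blast
    then have "Suc j * l \<le> k div l * l"
      by (intro mult_right_mono) auto
    also have "\<dots> \<le> k"
      by (rule div_times_less_eq_dividend)
    finally have "x \<le> k"
      using j(2) assms by (auto split: if_splits)
    then show "x \<in> {x \<in> {1..k}. x mod l = i}"
      using j(2) assms by (auto split: if_splits)
  qed
  ultimately show ?thesis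
    using card_inj_on_le[of ?f "{..<k div l}"] by simp
qed

lemma card_avoid_residue_le:
  assumes "i < l"
  shows "card (Pow {x \<in> {1..k}. x mod l \<noteq> i}) \<le> 2 ^ (k - k div l)"
proof -
  have "card {x \<in> {1..k}. x mod l \<noteq> i} = card ({1..k} - {x \<in> {1..k}. x mod l = i})"
    by (rule arg_cong[of _ _ card]) blast
  also have "\<dots> = k - card {x \<in> {1..k}. x mod l = i}"
    by (subst card_Diff_subset) auto
  also have "\<dots> \<le> k - k div l"
    using card_residue_class_ge[OF assms, of k] by (rule diff_le_mono2)
  finally show ?thesis
    by (simp add: card_Pow)
qed

text \<open>Averaging: the \<open>l\<close> residues of the sum partition the \<open>2 ^ k\<close>
  subsets, so some residue takes at most its average share.\<close>

lemma ex_rare_sum_residue: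
  assumes "0 < l"
  shows "\<exists>c<l. card {B \<in> Pow {1..k}. \<Sum>B mod l = c} * l \<le> 2 ^ k"
proof (rule ccontr)
  let ?f = "\<lambda>c. card {B \<in> Pow {1..k}. \<Sum>B mod l = c}"
  assume "\<not> ?thesis"
  then have "(\<Sum>c<l. 2 ^ k) < (\<Sum>c<l. ?f c * l)"
    using assms by (intro sum_strict_mono) auto
  also have "\<dots> = (\<Sum>c<l. ?f c) * l"
    by (simp add: sum_distrib_right)
  also have "(\<Sum>c<l. ?f c) = (\<Sum>B\<in>Pow {1..k}. 1)"
    unfolding card_eq_sum using assms by (intro sum.group) auto
  also have "\<dots> = 2 ^ k"
    by (simp add: card_Pow)
  finally show False
    by simp
qed

text \<open>The first term bounds the rare sum class, the second the \<open>l\<close> families each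
  avoiding one residue class; the outer factor 2 accounts for the complements.\<close>

lemma wsat_le_residue:
  assumes "k \<le> n" "0 < l"
  shows "real (wsat n k) \<le> 2 * (2 ^ k / real l + real l * 2 ^ (k - k div l))"
proof -
  obtain c where c: "c < l" "card {B \<in> Pow {1..k}. \<Sum>B mod l = c} * l \<le> 2 ^ k"
    using ex_rare_sum_residue[OF assms(2)] by blast
  let ?R = "{B \<in> Pow {1..k}. \<Sum>B mod l = c}"
  let ?M = "\<Union>i<l. Pow {x \<in> {1..k}. x mod l \<noteq> i}"
  have "real (card ?R) * real l \<le> 2 ^ k"
    using of_nat_mono[OF c(2), where ?'a = real] by (simp only: of_nat_mult of_nat_power of_nat_numeral)
  then have R: "real (card ?R) \<le> 2 ^ k / real l"
    using assms(2) by (simp add: le_divide_eq)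
  have "card ?M \<le> (\<Sum>i<l. card (Pow {x \<in> {1..k}. x mod l \<noteq> i}))"
    by (rule card_UN_le) simp
  also have "\<dots> \<le> (\<Sum>i<l. 2 ^ (k - k div l))"
    by (intro sum_mono card_avoid_residue_le) simp
  finally have "card ?M \<le> l * 2 ^ (k - k div l)"
    by simp
  from of_nat_mono[OF this, where ?'a = real] have "real (card ?M) \<le> real l * 2 ^ (k - k div l)"
    by (simp only: of_nat_mult of_nat_power of_nat_numeral)
  moreover have "real (card (residue_family k l c)) \<le> real (card ?M) + real (card ?R)"
    using of_nat_mono[OF card_Un_le[of ?M ?R], where ?'a = real]
    unfolding residue_family_def of_nat_add .
  ultimately have "real (card (residue_family k l c)) \<le> 2 ^ k / real l + real l * 2 ^ (k - k div l)"
    using R by linarith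
  then have "2 * real (card (residue_family k l c)) \<le> 2 * (2 ^ k / real l + real l * 2 ^ (k - k div l))"
    by (rule mult_left_mono) simp
  moreover have "residue_family k l c \<subseteq> Pow {1..k}"
    unfolding residue_family_def by blast
  then have "wsat n k \<le> 2 * card (residue_family k l c)"
    using residue_family_remove[OF c(1)] by (intro wsat_le_twice_card[OF assms(1)])
  then have "real (wsat n k) \<le> 2 * real (card (residue_family k l c))"
    by linarith
  ultimately show ?thesis
    by (rule order_trans[rotated])
qed

section \<open>Choosing the number of residue classes\<close>

text \<open>With \<open>L\<close> the integer part of the binary logarithm of \<open>k\<close>,
  taking \<open>l\<close> near \<open>k / (2 * L)\<close> makes \<open>2 ^ (k div l)\<close> at
  least \<open>k * k / 4\<close>. Both terms of \<open>wsat_le_residue\<close> are then at most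
  \<open>4 * L / k * 2 ^ k\<close>.\<close>

lemma wsat_le_log:
  assumes "6 \<le> k" "k \<le> n"
  shows "real (wsat n k) \<le> 32 * (ln (real k) / real k * 2 ^ k)"
proof -
  obtain L where L: "2 ^ L \<le> k" "k < 2 ^ (L + 1)"
    using ex_power_ivl1[of 2 k] assms(1) by auto
  have "L \<noteq> 0"
    using L(2) assms(1) by (intro notI) simp
  \<comment> \<open>Together with \<open>2 ^ L \<le> k\<close>, this makes the quotient
    \<open>l\<close> positive.\<close>
  then have pow: "2 * L \<le> 2 ^ L"
  proof (induction L)
    case (Suc m)
    then show ?case
      by (cases "m = 0") auto
  qed simp
  define l where "l = k div (2 * L)"
  have "0 < l"
    using pow L(1) \<open>L \<noteq> 0\<close> by (simp add: l_def div_greater_zero_iff)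
  have lk: "l * (2 * L) \<le> k"
    unfolding l_def by (rule div_times_less_eq_dividend)
  then have "2 * L \<le> k div l"
    using \<open>0 < l\<close> by (simp add: less_eq_div_iff_mult_less_eq mult.commute)
  have "k * k \<le> 4 * 2 ^ (k div l)"
  proof -
    have "k * k \<le> 2 ^ (L + 1) * 2 ^ (L + 1)"
      using L(2) by (intro mult_mono) auto
    also have "\<dots> = 4 * 2 ^ (2 * L)"
      by (simp add: power_add mult_2[of L])
    also have "\<dots> \<le> 4 * 2 ^ (k div l)"
      using \<open>2 * L \<le> k div l\<close> by simp
    finally show ?thesis .
  qed
  from of_nat_mono[OF this, where ?'a = real] have kk: "real k * real k \<le> 4 * 2 ^ (k div l)"
    by (simp only: of_nat_mult of_nat_power of_nat_numeral)
  \<comment> \<open>Rounding down in \<open>l\<close> costs at most a factor 2, so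
    \<open>1 / l\<close> is at most \<open>4 * L / k\<close>.\<close>
  have "k < Suc l * (2 * L)"
    using dividend_less_div_times[of "2 * L" k] \<open>L \<noteq> 0\<close> unfolding l_def by simp
  also have "\<dots> \<le> 2 * l * (2 * L)"
    using \<open>0 < l\<close> by (intro mult_right_mono) auto
  finally have "real k \<le> real (2 * l * (2 * L))"
    by linarith
  then have A: "2 ^ k / real l \<le> 4 * real L / real k * 2 ^ k"
    using \<open>0 < l\<close> assms(1) by (simp add: field_simps)
  have "l * 1 \<le> l * (2 * L)"
    using \<open>L \<noteq> 0\<close> by (intro mult_left_mono) auto
  then have "real l \<le> real k"
    using lk by linarith
  then have "real l * 2 ^ (k - k div l) \<le> real k * (2 ^ k / 2 ^ (k div l))"
    by (intro mult_mono) (auto simp: power_diff)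
  also have "\<dots> \<le> 4 / real k * 2 ^ k"
    using kk assms(1) by (simp add: field_simps)
  also have "\<dots> \<le> 4 * real L / real k * 2 ^ k"
    using \<open>L \<noteq> 0\<close> assms(1) by (intro mult_right_mono divide_right_mono) auto
  finally have B: "real l * 2 ^ (k - k div l) \<le> 4 * real L / real k * 2 ^ k" .
  note wsat_le_residue[OF assms(2) \<open>0 < l\<close>]
  also have "2 * (2 ^ k / real l + real l * 2 ^ (k - k div l)) \<le>
      2 * (4 * real L / real k * 2 ^ k + 4 * real L / real k * 2 ^ k)"
    by (intro mult_left_mono add_mono A B) simp
  also have "\<dots> = 16 * real L / real k * 2 ^ k"
    by simp
  \<comment> \<open>From \<open>L * ln 2 \<le> ln k\<close> and \<open>ln 2 \<ge> 1 / 2\<close> one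
    gets \<open>L \<le> 2 * ln k\<close>, which turns 16 into the final constant 32.\<close>
  also have "\<dots> \<le> 16 * (2 * ln (real k)) / real k * 2 ^ k"
  proof -
    have "ln (1 / 2 :: real) \<le> 1 / 2 - 1"
      by (rule ln_le_minus_one) simp
    then have "1 / 2 \<le> ln (2 :: real)"
      by (simp add: ln_div)
    then have "real L * (1 / 2) \<le> real L * ln 2"
      by (intro mult_left_mono) auto
    also have "\<dots> = ln (real (2 ^ L))"
      by (simp add: ln_realpow)
    also have "\<dots> \<le> ln (real k)"
      using L(1) assms(1) by (subst ln_le_cancel_iff) auto
    finally have "real L \<le> 2 * ln (real k)"
      by simp
    then show ?thesis
      by (intro mult_right_mono divide_right_mono mult_left_mono) auto
  qed
  finally show ?thesis
    by simp
qed

theorem theorem2: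
  shows "(\<forall>k n :: nat. 6 \<le> k \<and> k \<le> n \<longrightarrow> real (sat k k) \<le> 15 / 16 * 2 ^ (k - 1)) \<and>
         (\<exists>C :: real. \<forall>k n :: nat. 6 \<le> k \<and> k \<le> n \<longrightarrow>
            real (wsat n k) \<le> C * (ln (real k) / real k * 2 ^ k))"
  \<comment> \<open>The absolute constant is \<open>C = 32\<close>.\<close>
  using sat_self_le wsat_le_log by blast

end
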